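(* Let $(R,\mathfrak m)$ be a 2-dimensional Cohen-Macaulay local ring with infinite residue field, let $I$ and $J$ be $\mathfrak m$-primary ideals of $R$, and let $(x,y;z,w)$ be a complete reduction of $(I,J)$, with $x,y\in I$ and $z,w\in J$. Fix integers $r,s$. Then the map $$\frac{I^{2k+r}J^{2k+s}}{(xz,yw)^{[k]}I^{k+r}J^{k+s}}\ \xrightarrow{\ \mu\ }\ \frac{I^{2k+r+2}J^{2k+s+2}}{(xz,yw)^{[k+1]}I^{k+r+1}J^{k+s+1}}$$ induced by multiplication by $xzyw$ is an isomorphism for $k\gg 0$.
   Context: $(x,y;z,w)$ with $x,y\in I$, $z,w\in J$ is a complete reduction of $(I,J)$ if $(xz,yw)$ is a reduction of $IJ$, i.e. $(xz,yw)(IJ)^n=(IJ)^{n+1}$ for $n\gg0$. The symbol $(xz,yw)^{[k]}$ denotes the ideal $((xz)^k,(yw)^k)$ of $R$. Only $k$ large enough that all exponents are nonnegative are considered. *)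

theory Defs
  imports "HOL-Library.Extended_Nat" "HOL-Algebra.Algebra"
begin

section \<open>Cohen-Macaulay local rings\<close>

definition noetherian_local_ring :: "('a, 'b) ring_scheme \<Rightarrow> 'a set \<Rightarrow> bool" where
  "noetherian_local_ring R \<mm> \<longleftrightarrow>
     cring R \<and> noetherian_ring R \<and> maximalideal \<mm> R \<and> (\<forall>M. maximalideal M R \<longrightarrow> M = \<mm>)"

definition krull_dim :: "('a, 'b) ring_scheme \<Rightarrow> enat" where
  "krull_dim R = Sup {enat n | n. \<exists>P :: nat \<Rightarrow> 'a set.
     (\<forall>i\<le>n. primeideal (P i) R) \<and> (\<forall>i<n. P i \<subset> P (Suc i))}"

text \<open>The implication says that \<open>xs ! i\<close> is a nonzerodivisor on the quotient of \<open>R\<close> by the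
  ideal generated by the preceding entries.\<close>

definition regular_sequence :: "('a, 'b) ring_scheme \<Rightarrow> 'a list \<Rightarrow> bool" where
  "regular_sequence R xs \<longleftrightarrow>
     set xs \<subseteq> carrier R \<and> Idl\<^bsub>R\<^esub> (set xs) \<noteq> carrier R \<and>
     (\<forall>i<length xs. \<forall>a\<in>carrier R.
        xs ! i \<otimes>\<^bsub>R\<^esub> a \<in> Idl\<^bsub>R\<^esub> (set (take i xs)) \<longrightarrow> a \<in> Idl\<^bsub>R\<^esub> (set (take i xs)))"

definition ring_depth :: "('a, 'b) ring_scheme \<Rightarrow> 'a set \<Rightarrow> enat" where
  "ring_depth R \<mm> = Sup {enat (length xs) | xs. regular_sequence R xs \<and> set xs \<subseteq> \<mm>}"

definition cohen_macaulay_local_ring :: "('a, 'b) ring_scheme \<Rightarrow> 'a set \<Rightarrow> bool" where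
  "cohen_macaulay_local_ring R \<mm> \<longleftrightarrow>
     noetherian_local_ring R \<mm> \<and> ring_depth R \<mm> = krull_dim R"


section \<open>Ideals\<close>

definition ring_radical :: "('a, 'b) ring_scheme \<Rightarrow> 'a set \<Rightarrow> 'a set" where
  "ring_radical R Q = {a \<in> carrier R. \<exists>n::nat. a [^]\<^bsub>R\<^esub> n \<in> Q}"

definition primary_ideal :: "('a, 'b) ring_scheme \<Rightarrow> 'a set \<Rightarrow> bool" where
  "primary_ideal R Q \<longleftrightarrow> ideal Q R \<and> Q \<noteq> carrier R \<and>
     (\<forall>a\<in>carrier R. \<forall>b\<in>carrier R. a \<otimes>\<^bsub>R\<^esub> b \<in> Q \<longrightarrow> a \<in> Q \<or> b \<in> ring_radical R Q)"

definition primary_to :: "('a, 'b) ring_scheme \<Rightarrow> 'a set \<Rightarrow> 'a set \<Rightarrow> bool" where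
  "primary_to R P Q \<longleftrightarrow> primary_ideal R Q \<and> ring_radical R Q = P"

text \<open>Powers are taken in the multiplicative structure of \<^const>\<open>ideals_set\<close>: its multiplication is
  the ideal product and its unit is \<open>carrier R\<close>, so that the zeroth power is the unit ideal.\<close>

abbreviation ideal_pow :: "('a, 'b) ring_scheme \<Rightarrow> 'a set \<Rightarrow> nat \<Rightarrow> 'a set" where
  "ideal_pow R I n \<equiv> I [^]\<^bsub>ideals_set R\<^esub> n"

definition reduction_of :: "('a, 'b) ring_scheme \<Rightarrow> 'a set \<Rightarrow> 'a set \<Rightarrow> bool" where
  "reduction_of R L K \<longleftrightarrow> ideal L R \<and> ideal K R \<and> L \<subseteq> K \<and>
     (\<exists>n0. \<forall>n\<ge>n0. L \<cdot>\<^bsub>R\<^esub> ideal_pow R K n = ideal_pow R K (n + 1))"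

definition complete_reduction ::
    "('a, 'b) ring_scheme \<Rightarrow> 'a set \<Rightarrow> 'a set \<Rightarrow> 'a \<Rightarrow> 'a \<Rightarrow> 'a \<Rightarrow> 'a \<Rightarrow> bool" where
  "complete_reduction R I J x y z w \<longleftrightarrow>
     x \<in> I \<and> y \<in> I \<and> z \<in> J \<and> w \<in> J \<and>
     reduction_of R (Idl\<^bsub>R\<^esub> {x \<otimes>\<^bsub>R\<^esub> z, y \<otimes>\<^bsub>R\<^esub> w}) (I \<cdot>\<^bsub>R\<^esub> J)"

text \<open>The bracket power \<open>(a, b)\<^sup>[\<^sup>k\<^sup>]\<close>; it depends on the chosen generators \<open>a, b\<close>.\<close>

definition bracket_pow :: "('a, 'b) ring_scheme \<Rightarrow> 'a \<Rightarrow> 'a \<Rightarrow> nat \<Rightarrow> 'a set" where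
  "bracket_pow R a b k = Idl\<^bsub>R\<^esub> {a [^]\<^bsub>R\<^esub> k, b [^]\<^bsub>R\<^esub> k}"


section \<open>Quotients of ideals as modules\<close>

text \<open>The \<open>R\<close>-module \<open>K / N\<close> for ideals \<open>N \<subseteq> K\<close>. The record type of modules also has the fields
  \<open>mult\<close> and \<open>one\<close>, which play no role for a module.\<close>

definition ideal_quotient :: "('a, 'b) ring_scheme \<Rightarrow> 'a set \<Rightarrow> 'a set \<Rightarrow> ('a, 'a set) module" where
  "ideal_quotient R K N =
     \<lparr>carrier = {N +>\<^bsub>R\<^esub> a | a. a \<in> K}, monoid.mult = undefined, one = undefined,
      ring.zero = N, add = set_add R, smult = (\<lambda>c C. \<Union>a\<in>C. N +>\<^bsub>R\<^esub> (c \<otimes>\<^bsub>R\<^esub> a))\<rparr>"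

lemma (in cring) ideal_quotient_module:
  assumes "ideal N R" and "ideal K R"
  shows "module R (ideal_quotient R K N)"
proof -
  interpret N: ideal N R by fact
  interpret K: ideal K R by fact
  have add: "(N +> a) <+> (N +> b) = N +> (a \<oplus> b)" if "a \<in> carrier R" "b \<in> carrier R" for a b
    using that by (rule N.a_rcos_sum)
  have smult: "(\<Union>a'\<in>N +> a. N +> (c \<otimes> a')) = N +> (c \<otimes> a)"
    if a: "a \<in> carrier R" and c: "c \<in> carrier R" for a c
  proof -
    have "N +> (c \<otimes> a') = N +> (c \<otimes> a)" if a': "a' \<in> N +> a" for a'
    proof -
      from a' obtain h where h: "h \<in> N" "a' = h \<oplus> a" by (auto simp: a_r_coset_def')
      then have hc: "h \<in> carrier R" by (simp add: N.a_Hcarr)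
      have "c \<otimes> a' = c \<otimes> h \<oplus> c \<otimes> a" using h a c hc by (simp add: r_distr)
      moreover have "c \<otimes> h \<in> N" using h c by (simp add: N.I_l_closed)
      ultimately have "c \<otimes> a' \<in> N +> (c \<otimes> a)" by (auto simp: a_r_coset_def')
      then show ?thesis using a c by (metis a_repr_independence m_closed N.a_subgroup)
    qed
    moreover have "a \<in> N +> a" using a by (simp add: N.a_rcos_self)
    ultimately show ?thesis by blast
  qed
  have zero: "N = N +> \<zero>" by (simp add: N.a_subset)
  let ?Q = "ideal_quotient R K N"
  have carI: "N +> a \<in> carrier ?Q" if "a \<in> K" for a
    using that by (auto simp: ideal_quotient_def)
  have carE: "\<exists>a\<in>K. u = N +> a" if "u \<in> carrier ?Q" for u
    using that by (auto simp: ideal_quotient_def)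
  have addQ: "(N +> a) \<oplus>\<^bsub>?Q\<^esub> (N +> b) = N +> (a \<oplus> b)" if "a \<in> K" "b \<in> K" for a b
    using that by (simp add: ideal_quotient_def add K.a_Hcarr)
  have smultQ: "c \<odot>\<^bsub>?Q\<^esub> (N +> a) = N +> (c \<otimes> a)" if "a \<in> K" "c \<in> carrier R" for a c
    using that by (simp add: ideal_quotient_def smult K.a_Hcarr)
  have zeroQ: "\<zero>\<^bsub>?Q\<^esub> = N +> \<zero>"
    using zero by (simp add: ideal_quotient_def)
  note closed = K.a_closed K.I_l_closed K.zero_closed K.a_inv_closed
  note Q = carI addQ smultQ zeroQ closed K.a_Hcarr
  show ?thesis
  proof (rule moduleI)
    show "cring R" ..
    show "abelian_group ?Q"
    proof (rule abelian_groupI)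
      show "\<exists>v\<in>carrier ?Q. v \<oplus>\<^bsub>?Q\<^esub> u = \<zero>\<^bsub>?Q\<^esub>" if u: "u \<in> carrier ?Q" for u
      proof -
        from carE[OF u] obtain a where a: "a \<in> K" "u = N +> a" by blast
        then have "(N +> \<ominus> a) \<oplus>\<^bsub>?Q\<^esub> u = \<zero>\<^bsub>?Q\<^esub>" by (simp add: Q l_neg)
        then show ?thesis using a carI closed by blast
      qed
    qed (auto dest!: carE simp: Q a_ac)
  qed (auto dest!: carE simp: Q l_distr r_distr m_assoc)
qed

definition module_homs ::
    "('a, 'm) ring_scheme \<Rightarrow> ('a, 'b, 'n) module_scheme \<Rightarrow> ('a, 'c, 'k) module_scheme \<Rightarrow> ('b \<Rightarrow> 'c) set" where
  "module_homs R M N = {f \<in> carrier M \<rightarrow> carrier N.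
     (\<forall>u\<in>carrier M. \<forall>v\<in>carrier M. f (u \<oplus>\<^bsub>M\<^esub> v) = f u \<oplus>\<^bsub>N\<^esub> f v) \<and>
     (\<forall>c\<in>carrier R. \<forall>u\<in>carrier M. f (c \<odot>\<^bsub>M\<^esub> u) = c \<odot>\<^bsub>N\<^esub> f u)}"

definition module_isos ::
    "('a, 'm) ring_scheme \<Rightarrow> ('a, 'b, 'n) module_scheme \<Rightarrow> ('a, 'c, 'k) module_scheme \<Rightarrow> ('b \<Rightarrow> 'c) set" where
  "module_isos R M N = {f \<in> module_homs R M N. bij_betw f (carrier M) (carrier N)}"

text \<open>Multiplication by \<open>c\<close> induces an isomorphism \<open>K / N \<rightarrow> K' / N'\<close>. The displayed equation says
  that the induced map is well defined, and it determines \<open>\<mu>\<close> on \<open>K / N\<close>.\<close>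

definition mult_induces_iso ::
    "('a, 'b) ring_scheme \<Rightarrow> 'a \<Rightarrow> 'a set \<Rightarrow> 'a set \<Rightarrow> 'a set \<Rightarrow> 'a set \<Rightarrow> bool" where
  "mult_induces_iso R c K N K' N' \<longleftrightarrow>
     (\<exists>\<mu> \<in> module_isos R (ideal_quotient R K N) (ideal_quotient R K' N').
        \<forall>a\<in>K. \<mu> (N +>\<^bsub>R\<^esub> a) = N' +>\<^bsub>R\<^esub> (c \<otimes>\<^bsub>R\<^esub> a))"

end

theory Submission
  imports Defs
begin

text \<open>Write \<open>a = xz\<close>, \<open>b = yw\<close> and let \<open>M\<^sub>k\<close> be the source of \<open>\<mu>\<close>. Once all exponents are large, the
  reduction property gives \<open>I\<^sup>p\<^sup>+\<^sup>1J\<^sup>q\<^sup>+\<^sup>1 = (a, b)I\<^sup>pJ\<^sup>q\<close>, and \<open>(a, b)\<^sup>k\<^sup>+\<^sup>1 = (a\<^sup>k\<^sup>+\<^sup>1, b\<^sup>k\<^sup>+\<^sup>1) + ab(a, b)\<^sup>k\<^sup>-\<^sup>1\<close>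
  shows that \<open>\<mu> : M\<^sub>k \<rightarrow> M\<^sub>k\<^sub>+\<^sub>1\<close> is surjective. In a direct system \<open>M\<^sub>0 \<rightarrow> M\<^sub>1 \<rightarrow> \<dots>\<close> of surjections with
  \<open>M\<^sub>0\<close> noetherian, the kernels of \<open>M\<^sub>0 \<rightarrow> M\<^sub>k\<close> form an ascending chain; once it is stationary, the
  maps \<open>M\<^sub>k \<rightarrow> M\<^sub>k\<^sub>+\<^sub>1\<close> are injective.\<close>

section \<open>Maps between quotients of ideals induced by multiplication\<close>

text \<open>Two representatives of \<open>N +> a\<close> differ by an element of \<open>N\<close>,
  which \<open>c\<close> sends into \<open>N'\<close>. With \<open>N' = N\<close> this computes
  scalar multiplication in a quotient; in general it computes the induced map.\<close>

lemma (in cring) UN_rcos_mult: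
  assumes "ideal N R" "ideal N' R" "c \<in> carrier R" "a \<in> carrier R"
    and sub: "\<And>u. u \<in> N \<Longrightarrow> c \<otimes> u \<in> N'"
  shows "(\<Union>a'\<in>N +> a. N' +> (c \<otimes> a')) = N' +> (c \<otimes> a)"
proof -
  interpret N: ideal N R by fact
  interpret N': ideal N' R by fact
  have "N' +> (c \<otimes> a') = N' +> (c \<otimes> a)" if a': "a' \<in> N +> a" for a'
  proof -
    from a' obtain h where h: "h \<in> N" "a' = h \<oplus> a" by (auto simp: a_r_coset_def')
    then have "c \<otimes> a' = c \<otimes> h \<oplus> c \<otimes> a"
      using assms by (simp add: N.a_Hcarr r_distr)
    then have "c \<otimes> a' \<in> N' +> (c \<otimes> a)" using sub[OF h(1)] by (auto simp: a_r_coset_def')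
    then show ?thesis using assms by (metis a_repr_independence m_closed N'.a_subgroup)
  qed
  moreover have "a \<in> N +> a" using assms by (simp add: N.a_rcos_self)
  ultimately show ?thesis by blast
qed

lemma (in cring) rcos_eq_iff:
  assumes "ideal N R" "a \<in> carrier R" "b \<in> carrier R"
  shows "N +> a = N +> b \<longleftrightarrow> a \<ominus> b \<in> N"
proof -
  interpret N: ideal N R by fact
  show ?thesis
    using assms N.a_rcos_module_minus[OF ring_axioms, of b a] N.a_repr_independence' N.a_rcos_self
    by metis
qed

text \<open>Translates the isomorphism into conditions on ring elements: \<open>inj\<close> is
  triviality of the kernel, and \<open>surj\<close> says that every coset of \<open>N'\<close> in
  \<open>K'\<close> has a representative of the form \<open>c u\<close> with \<open>u\<close> in
  \<open>K\<close>.\<close>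

lemma (in cring) mult_induces_isoI:
  assumes "ideal N R" "ideal K R" "ideal N' R" "ideal K' R" and c: "c \<in> carrier R"
    and K: "\<And>u. u \<in> K \<Longrightarrow> c \<otimes> u \<in> K'"
    and N: "\<And>u. u \<in> N \<Longrightarrow> c \<otimes> u \<in> N'"
    and inj: "\<And>u. u \<in> K \<Longrightarrow> c \<otimes> u \<in> N' \<Longrightarrow> u \<in> N"
    and surj: "\<And>v. v \<in> K' \<Longrightarrow> \<exists>u\<in>K. \<exists>n\<in>N'. v = c \<otimes> u \<oplus> n"
  shows "mult_induces_iso R c K N K' N'"
proof -
  interpret N: ideal N R by fact
  interpret K: ideal K R by fact
  interpret N': ideal N' R by fact
  interpret K': ideal K' R by fact
  let ?Q = "ideal_quotient R K N" and ?Q' = "ideal_quotient R K' N'"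
  \<comment> \<open>Taking the union over all representatives avoids a choice; by
    \<open>UN_rcos_mult\<close> it is a single coset.\<close>
  let ?\<mu> = "\<lambda>C. \<Union>a\<in>C. N' +> (c \<otimes> a)"
  note Kc = K.a_Hcarr and K'c = K'.a_Hcarr
  have \<mu>: "?\<mu> (N +> a) = N' +> (c \<otimes> a)" if "a \<in> K" for a
    using UN_rcos_mult[OF assms(1,3) c Kc[OF that] N] .
  have carE: "\<exists>a\<in>K. u = N +> a" if "u \<in> carrier ?Q" for u
    using that by (auto simp: ideal_quotient_def)
  have car': "N' +> a \<in> carrier ?Q'" if "a \<in> K'" for a
    using that by (auto simp: ideal_quotient_def)
  have "?\<mu> \<in> module_homs R ?Q ?Q'"
    unfolding module_homs_def
  proof (intro CollectI conjI ballI Pi_I)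
    fix u assume "u \<in> carrier ?Q"
    then show "?\<mu> u \<in> carrier ?Q'" using carE \<mu> car' K by metis
  next
    fix u v assume "u \<in> carrier ?Q" "v \<in> carrier ?Q"
    then obtain a b where ab: "a \<in> K" "u = N +> a" "b \<in> K" "v = N +> b" using carE by meson
    have "u \<oplus>\<^bsub>?Q\<^esub> v = N +> (a \<oplus> b)"
      using ab by (simp add: ideal_quotient_def N.a_rcos_sum Kc)
    moreover have "?\<mu> u \<oplus>\<^bsub>?Q'\<^esub> ?\<mu> v = N' +> (c \<otimes> a \<oplus> c \<otimes> b)"
      unfolding ab \<mu>[OF ab(1)] \<mu>[OF ab(3)]
      using ab c by (simp add: ideal_quotient_def N'.a_rcos_sum Kc)
    ultimately show "?\<mu> (u \<oplus>\<^bsub>?Q\<^esub> v) = ?\<mu> u \<oplus>\<^bsub>?Q'\<^esub> ?\<mu> v"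
      using \<mu>[of "a \<oplus> b"] ab c by (simp add: r_distr Kc)
  next
    fix d u assume d: "d \<in> carrier R" and "u \<in> carrier ?Q"
    then obtain a where a: "a \<in> K" "u = N +> a" using carE by meson
    have "d \<odot>\<^bsub>?Q\<^esub> u = N +> (d \<otimes> a)"
      using UN_rcos_mult[of N N d a] a d assms(1) Kc by (simp add: ideal_quotient_def N.I_l_closed)
    moreover have "d \<odot>\<^bsub>?Q'\<^esub> ?\<mu> u = N' +> (d \<otimes> (c \<otimes> a))"
      unfolding a \<mu>[OF a(1)]
      using UN_rcos_mult[of N' N' d "c \<otimes> a"] a d c assms(3) Kc
      by (simp add: ideal_quotient_def N'.I_l_closed)
    ultimately show "?\<mu> (d \<odot>\<^bsub>?Q\<^esub> u) = d \<odot>\<^bsub>?Q'\<^esub> ?\<mu> u"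
      using \<mu>[of "d \<otimes> a"] a c d K.I_l_closed by (simp add: m_lcomm Kc)
  qed
  moreover have "bij_betw ?\<mu> (carrier ?Q) (carrier ?Q')"
  proof (rule bij_betw_imageI; (rule inj_onI | intro equalityI subsetI))
    fix u v assume "u \<in> carrier ?Q" "v \<in> carrier ?Q" and eq: "?\<mu> u = ?\<mu> v"
    then obtain a b where ab: "a \<in> K" "u = N +> a" "b \<in> K" "v = N +> b" using carE by meson
    have "c \<otimes> a \<ominus> c \<otimes> b \<in> N'"
      using eq rcos_eq_iff[OF assms(3)] c Kc ab \<mu> by simp
    moreover have "c \<otimes> a \<ominus> c \<otimes> b = c \<otimes> (a \<ominus> b)"
      using c ab Kc by (simp add: minus_eq r_distr r_minus)
    ultimately have "a \<ominus> b \<in> N"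
      using inj[of "a \<ominus> b"] ab by (simp add: minus_eq)
    then show "u = v" using rcos_eq_iff[OF assms(1)] ab Kc by simp
  next
    fix C assume "C \<in> ?\<mu> ` carrier ?Q"
    then obtain u where "u \<in> carrier ?Q" "C = ?\<mu> u" by blast
    then show "C \<in> carrier ?Q'" using carE \<mu> car' K by metis
  next
    fix C assume "C \<in> carrier ?Q'"
    then obtain v where v: "v \<in> K'" "C = N' +> v" by (auto simp: ideal_quotient_def)
    then obtain u n where u: "u \<in> K" and n: "n \<in> N'" and eq: "v = c \<otimes> u \<oplus> n" using surj by meson
    have "v \<ominus> c \<otimes> u = n"
      using u n c Kc N'.a_Hcarr eq by (simp add: minus_eq a_ac r_neg)
    then have "C = ?\<mu> (N +> u)"
      using v n u c Kc K'c rcos_eq_iff[OF assms(3)] \<mu> by simp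
    moreover have "N +> u \<in> carrier ?Q" using u by (auto simp: ideal_quotient_def)
    ultimately show "C \<in> ?\<mu> ` carrier ?Q" by blast
  qed
  ultimately have "?\<mu> \<in> module_isos R ?Q ?Q'"
    unfolding module_isos_def by (intro CollectI conjI)
  then show ?thesis
    unfolding mult_induces_iso_def by (intro bexI[of _ ?\<mu>] ballI \<mu>)
qed

section \<open>Ascending chains and direct systems of surjections\<close>

text \<open>The range of the sequence is a chain under inclusion, so in a noetherian ring its union
  is one of its members; the index of that member serves as \<open>m\<close>.\<close>

lemma (in noetherian_ring) ideal_seq_stabilizes:
  assumes ideal: "\<And>n::nat. ideal (A n) R" and step: "\<And>n. A n \<subseteq> A (Suc n)"
  shows "\<exists>m. \<forall>n\<ge>m. A n = A m"
proof -
  have mono: "A i \<subseteq> A j" if "i \<le> j" for i j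
    using that using lift_Suc_mono_le[of A i j] step by blast
  have "subset.chain {I. ideal I R} (range A)"
    unfolding pred_on.chain_def using ideal mono by (auto; metis nat_le_linear subsetD)
  then have "\<Union>(range A) \<in> range A" by (intro ideal_chain_is_trivial) auto
  then obtain m where m: "\<Union>(range A) = A m" by blast
  have "A n = A m" if "n \<ge> m" for n
    using mono[OF that] m by blast
  then show ?thesis by blast
qed

text \<open>An element of \<open>K n\<close> killed at the next stage lifts to \<open>K 0\<close>,
  and the lift is in the kernel of the composite to stage \<open>Suc n\<close>. Once these kernels
  stop growing, the element is already zero at stage \<open>n\<close>.\<close>

lemma (in cring) surjective_system_eventually_injective:
  assumes "noetherian_ring R" and c: "c \<in> carrier R"
    and idK: "\<And>n::nat. ideal (K n) R" and idN: "\<And>n. ideal (N n) R"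
    and N: "\<And>n u. u \<in> N n \<Longrightarrow> c \<otimes> u \<in> N (Suc n)"
    and surj: "\<And>n v. v \<in> K (Suc n) \<Longrightarrow> \<exists>u\<in>K n. \<exists>t\<in>N (Suc n). v = c \<otimes> u \<oplus> t"
  shows "\<exists>m. \<forall>n\<ge>m. \<forall>u\<in>K n. c \<otimes> u \<in> N (Suc n) \<longrightarrow> u \<in> N n"
proof -
  interpret noetherian_ring R by fact
  \<comment> \<open>The kernel of \<open>K 0 / N 0\<close> \<rightarrow> \<open>K n / N n\<close>,
    pulled back to \<open>K 0\<close>. This makes it an ideal of \<open>R\<close>, so the chain
    condition on ideals applies directly.\<close>
  define A where "A n = {u \<in> K 0. c [^] n \<otimes> u \<in> N n}" for n :: nat
  have Kc: "u \<in> carrier R" if "u \<in> K n" for u n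
    using idK that by (metis ideal.Icarr)
  have Nc: "u \<in> carrier R" if "u \<in> N n" for u n
    using idN that by (metis ideal.Icarr)
  have pow: "c [^] Suc n \<otimes> u = c \<otimes> (c [^] n \<otimes> u)" if "u \<in> carrier R" for u n
    using c that by (simp add: m_ac)
  have "ideal (A n) R" for n
  proof -
    interpret K0: ideal "K 0" R by (rule idK)
    interpret Nn: ideal "N n" R by (rule idN)
    have cn: "c [^] n \<in> carrier R" using c by simp
    have swap: "c [^] n \<otimes> (u \<otimes> v) = (c [^] n \<otimes> u) \<otimes> v"
      "c [^] n \<otimes> (v \<otimes> u) = v \<otimes> (c [^] n \<otimes> u)"
      if "u \<in> K 0" "v \<in> carrier R" for u v
      using that cn by (simp_all add: m_ac K0.a_Hcarr)
    show ?thesis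
    proof (rule idealI)
      show "subgroup (A n) (add_monoid R)"
      proof (rule add.subgroupI)
        show "A n \<noteq> {}"
          using cn K0.zero_closed Nn.zero_closed unfolding A_def
          by (metis (mono_tags, lifting) empty_iff mem_Collect_eq r_null)
      qed (use cn in \<open>auto simp: A_def K0.a_Hcarr r_distr r_minus
              simp flip: a_inv_def\<close>)
    qed (auto simp: A_def swap ring_axioms K0.I_l_closed K0.I_r_closed Nn.I_l_closed Nn.I_r_closed)
  qed
  moreover have "A n \<subseteq> A (Suc n)" for n
    using N pow Kc unfolding A_def by auto
  ultimately obtain m where m: "\<forall>n\<ge>m. A n = A m" using ideal_seq_stabilizes[of A] by blast
  \<comment> \<open>Surjectivity iterated down to \<open>K 0\<close>; the error from stage
    \<open>n\<close>, multiplied by \<open>c\<close>, lands in \<open>N (Suc n)\<close> and joins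
    the new one.\<close>
  have reach: "\<exists>u\<in>K 0. \<exists>t\<in>N n. v = c [^] n \<otimes> u \<oplus> t" if "v \<in> K n" for n v
    using that
  proof (induction n arbitrary: v)
    case 0
    then show ?case
      using Kc idN[THEN ideal.axioms(1), THEN additive_subgroup.zero_closed]
      by (metis l_one nat_pow_0 r_zero)
  next
    case (Suc n)
    from surj[OF Suc.prems] obtain u' t' where 1: "u' \<in> K n" "t' \<in> N (Suc n)" "v = c \<otimes> u' \<oplus> t'"
      by blast
    from Suc.IH[OF 1(1)] obtain u t where 2: "u \<in> K 0" "t \<in> N n" "u' = c [^] n \<otimes> u \<oplus> t"
      by blast
    have "v = c [^] Suc n \<otimes> u \<oplus> (c \<otimes> t \<oplus> t')"
      using 1 2 c Kc Nc pow[of u n] by (simp add: r_distr a_assoc del: nat_pow_Suc)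
    moreover have "c \<otimes> t \<oplus> t' \<in> N (Suc n)"
      using N[OF 2(2)] 1(2) idN by (simp add: additive_subgroup.a_closed ideal.axioms(1))
    ultimately show ?case using 2(1) by blast
  qed
  have "v \<in> N n" if n: "n \<ge> m" and v: "v \<in> K n" "c \<otimes> v \<in> N (Suc n)" for n v
  proof -
    interpret Nn: ideal "N n" R by (rule idN)
    interpret NS: ideal "N (Suc n)" R by (rule idN)
    from reach[OF v(1)] obtain u t where ut: "u \<in> K 0" "t \<in> N n" "v = c [^] n \<otimes> u \<oplus> t" by blast
    \<comment> \<open>Both terms on the right lie in \<open>N (Suc n)\<close>, which puts
      \<open>u\<close> into \<open>A (Suc n) = A n\<close>.\<close>
    have "c [^] Suc n \<otimes> u = c \<otimes> v \<ominus> c \<otimes> t"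
      using ut c Kc Nc pow[of u n] by (simp add: r_distr minus_eq a_assoc r_neg del: nat_pow_Suc)
    then have "c [^] Suc n \<otimes> u \<in> N (Suc n)"
      using v(2) N[OF ut(2)] by (simp add: minus_eq del: nat_pow_Suc)
    then have "u \<in> A (Suc n)" using ut(1) unfolding A_def by simp
    then have "u \<in> A n" using m n by (metis le_SucI)
    then show ?thesis using ut unfolding A_def by simp
  qed
  then show ?thesis by blast
qed

section \<open>Products with the ideal \<open>(a, b)\<close> and chains
  \<open>H (Suc j) = (a, b) H j\<close>\<close>

text \<open>The parentheses are needed: \<open>Idl A \<cdot> H\<close> parses as \<open>Idl (A \<cdot> H)\<close>.\<close>

lemma (in cring) genideal_pair_prod_iff:
  assumes a: "a \<in> carrier R" and b: "b \<in> carrier R" and H: "ideal H R"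
  shows "v \<in> (Idl {a, b}) \<cdot> H \<longleftrightarrow> (\<exists>f\<in>H. \<exists>g\<in>H. v = a \<otimes> f \<oplus> b \<otimes> g)"
proof
  interpret H: ideal H R by fact
  \<comment> \<open>The sum of the principal ideals supplies explicit coefficients
    \<open>p a + q b\<close> for the first factor in the induction below.\<close>
  have sub: "Idl {a, b} \<subseteq> PIdl a <+> PIdl b"
  proof (rule genideal_minimal)
    have "a \<oplus> \<zero> \<in> PIdl a <+> PIdl b" "\<zero> \<oplus> b \<in> PIdl a <+> PIdl b"
      using a b cgenideal_self cgenideal_ideal[THEN ideal.axioms(1), THEN additive_subgroup.zero_closed]
      unfolding set_add_def' by blast+
    then show "{a, b} \<subseteq> PIdl a <+> PIdl b" using a b by simp
  qed (simp add: a b add_ideals cgenideal_ideal)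
  show "\<exists>f\<in>H. \<exists>g\<in>H. v = a \<otimes> f \<oplus> b \<otimes> g" if "v \<in> (Idl {a, b}) \<cdot> H"
    using that
  proof (induction rule: ideal_prod.induct)
    case (prod i h)
    then obtain p q where "p \<in> carrier R" "q \<in> carrier R" "i = p \<otimes> a \<oplus> q \<otimes> b"
      using sub unfolding set_add_def' cgenideal_def by blast
    moreover from this have "i \<otimes> h = a \<otimes> (p \<otimes> h) \<oplus> b \<otimes> (q \<otimes> h)"
      using a b prod H.a_Hcarr by (simp add: l_distr r_distr m_ac)
    ultimately show ?case using prod H.I_l_closed by blast
  next
    case (sum s1 s2)
    then obtain f1 g1 f2 g2 where h: "f1 \<in> H" "g1 \<in> H" "f2 \<in> H" "g2 \<in> H"
      and "s1 = a \<otimes> f1 \<oplus> b \<otimes> g1" "s2 = a \<otimes> f2 \<oplus> b \<otimes> g2" by blast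
    then have "s1 \<oplus> s2 = a \<otimes> (f1 \<oplus> f2) \<oplus> b \<otimes> (g1 \<oplus> g2)"
      using a b H.a_Hcarr by (simp add: r_distr a_ac)
    then show ?case using h H.a_closed by blast
  qed
  show "v \<in> (Idl {a, b}) \<cdot> H" if "\<exists>f\<in>H. \<exists>g\<in>H. v = a \<otimes> f \<oplus> b \<otimes> g"
    using that genideal_self[of "{a, b}"] a b by (auto intro!: ideal_prod.intros)
qed

lemma (in cring) genideal_pair_prodI:
  assumes "a \<in> carrier R" "b \<in> carrier R" "f \<in> H"
  shows "a \<otimes> f \<in> (Idl {a, b}) \<cdot> H" and "b \<otimes> f \<in> (Idl {a, b}) \<cdot> H"
  using assms genideal_self[of "{a, b}"] by (auto intro: ideal_prod.prod)

text \<open>This is the containment \<open>(a, b)\<^sup>k \<subseteq> (a\<^sup>k, b\<^sup>k) + ab(a, b)\<^sup>k\<^sup>-\<^sup>2\<close>, applied to \<open>H 0\<close>.\<close>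

lemma (in cring) reduction_chain_decomposition:
  assumes a: "a \<in> carrier R" and b: "b \<in> carrier R" and H: "\<And>j::nat. ideal (H j) R"
    and red: "\<And>j. (Idl {a, b}) \<cdot> H j = H (Suc j)"
    and "v \<in> H (Suc (Suc j))"
  shows "\<exists>f\<in>H 0. \<exists>g\<in>H 0. \<exists>h\<in>H j.
           v = a [^] Suc (Suc j) \<otimes> f \<oplus> b [^] Suc (Suc j) \<otimes> g \<oplus> a \<otimes> b \<otimes> h"
  using assms(5)
proof (induction j arbitrary: v)
  have car: "u \<in> carrier R" if "u \<in> H j" for u j using H that by (metis ideal.Icarr)
  have split: "\<exists>f\<in>H j. \<exists>g\<in>H j. u = a \<otimes> f \<oplus> b \<otimes> g" if "u \<in> H (Suc j)" for u j
    using that genideal_pair_prod_iff[OF a b H] red by blast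
  have aH: "a \<otimes> f \<in> H (Suc j)" and bH: "b \<otimes> f \<in> H (Suc j)" if "f \<in> H j" for f j
    using genideal_pair_prodI[OF a b that] red by auto
  have closed: "f \<oplus> g \<in> H j" if "f \<in> H j" "g \<in> H j" for f g j
    using that H by (simp add: additive_subgroup.a_closed ideal.axioms(1))
  {
    case 0
    then obtain u1 u2 where u: "u1 \<in> H 1" "u2 \<in> H 1" "v = a \<otimes> u1 \<oplus> b \<otimes> u2"
      using split by fastforce
    then obtain f1 g1 f2 g2 where h: "f1 \<in> H 0" "g1 \<in> H 0" "f2 \<in> H 0" "g2 \<in> H 0"
      and e: "u1 = a \<otimes> f1 \<oplus> b \<otimes> g1" "u2 = a \<otimes> f2 \<oplus> b \<otimes> g2"
      using split by (metis One_nat_def)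
    note h' = h[THEN car]
    \<comment> \<open>The two cross terms \<open>a b g1\<close> and \<open>b a f2\<close> make up
      the multiple of \<open>a b\<close>.\<close>
    have "v = a [^] Suc (Suc 0) \<otimes> f1 \<oplus> b [^] Suc (Suc 0) \<otimes> g2 \<oplus> a \<otimes> b \<otimes> (g1 \<oplus> f2)"
      unfolding u e using a b h' by (simp add: r_distr l_distr a_ac m_ac)
    then show ?case using h closed by blast
  next
    case (Suc j)
    then obtain u1 u2 where u: "u1 \<in> H (Suc (Suc j))" "u2 \<in> H (Suc (Suc j))"
      "v = a \<otimes> u1 \<oplus> b \<otimes> u2"
      using split by blast
    from Suc.IH[OF u(1)] obtain f1 g1 h1 where 1: "f1 \<in> H 0" "g1 \<in> H 0" "h1 \<in> H j"
      "u1 = a [^] Suc (Suc j) \<otimes> f1 \<oplus> b [^] Suc (Suc j) \<otimes> g1 \<oplus> a \<otimes> b \<otimes> h1" by blast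
    from Suc.IH[OF u(2)] obtain f2 g2 h2 where 2: "f2 \<in> H 0" "g2 \<in> H 0" "h2 \<in> H j"
      "u2 = a [^] Suc (Suc j) \<otimes> f2 \<oplus> b [^] Suc (Suc j) \<otimes> g2 \<oplus> a \<otimes> b \<otimes> h2" by blast
    have pow: "a [^] i \<otimes> f \<in> H i" "b [^] i \<otimes> f \<in> H i" if f: "f \<in> H 0" for f and i :: nat
    proof (induction i)
      case 0
      { case 1 show ?case using f car by simp }
      { case 2 show ?case using f car by simp }
    next
      case (Suc i)
      { case 1 show ?case using aH[OF Suc(1)] a car[OF f] by (simp add: m_ac) }
      { case 2 show ?case using bH[OF Suc(2)] b car[OF f] by (simp add: m_ac) }
    qed
    let ?c = "a \<otimes> b"
    \<comment> \<open>In \<open>a u1\<close> only the pure power of \<open>a\<close> grows; the term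
      in \<open>g1\<close> acquires a factor \<open>a\<close> and becomes a multiple of
      \<open>a b\<close>, with one power of \<open>b\<close> fewer. The same happens in
      \<open>b u2\<close> with the roles exchanged.\<close>
    let ?h1 = "b [^] Suc j \<otimes> g1 \<oplus> a \<otimes> h1" and ?h2 = "a [^] Suc j \<otimes> f2 \<oplus> b \<otimes> h2"
    have h: "?h1 \<in> H (Suc j)" "?h2 \<in> H (Suc j)"
      by (intro closed pow aH bH 1 2)+
    have "a \<otimes> u1 = a [^] Suc (Suc (Suc j)) \<otimes> f1 \<oplus> ?c \<otimes> ?h1"
      unfolding 1(4) using a b 1(1-3)[THEN car] by (simp add: r_distr a_assoc m_ac)
    moreover have "b \<otimes> u2 = b [^] Suc (Suc (Suc j)) \<otimes> g2 \<oplus> ?c \<otimes> ?h2"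
      unfolding 2(4) using a b 2(1-3)[THEN car] by (simp add: r_distr a_ac m_ac)
    moreover have "(X1 \<oplus> ?c \<otimes> Y1) \<oplus> (X2 \<oplus> ?c \<otimes> Y2) = X1 \<oplus> X2 \<oplus> ?c \<otimes> (Y1 \<oplus> Y2)"
      if "X1 \<in> carrier R" "X2 \<in> carrier R" "Y1 \<in> carrier R" "Y2 \<in> carrier R" for X1 X2 Y1 Y2
      using that a b by (simp add: r_distr a_ac)
    ultimately have "v = a [^] Suc (Suc (Suc j)) \<otimes> f1 \<oplus> b [^] Suc (Suc (Suc j)) \<otimes> g2
        \<oplus> ?c \<otimes> (?h1 \<oplus> ?h2)"
      unfolding u(3) using a b 1(1)[THEN car] 2(2)[THEN car] h[THEN car] by (simp del: nat_pow_Suc)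
    moreover have "?h1 \<oplus> ?h2 \<in> H (Suc j)" using h by (rule closed)
    ultimately show ?case using 1(1) 2(2) by blast
  }
qed

text \<open>Multiplication by \<open>a b\<close> raises the index in the chain by two, hence the
  sources \<open>H (k + 2 * n)\<close>. The decomposition gives surjectivity at every stage, and the
  noetherian argument then gives injectivity for large \<open>n\<close>.\<close>

lemma (in cring) reduction_chain_mult_induces_iso:
  assumes "noetherian_ring R" and a: "a \<in> carrier R" and b: "b \<in> carrier R"
    and H: "\<And>j::nat. ideal (H j) R"
    and red: "\<And>j. (Idl {a, b}) \<cdot> H j = H (Suc j)" and "0 < k"
  shows "\<exists>m. \<forall>n\<ge>m. mult_induces_iso R (a \<otimes> b)
           (H (k + 2 * n)) (bracket_pow R a b (k + n) \<cdot> H n)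
           (H (k + 2 * Suc n)) (bracket_pow R a b (k + Suc n) \<cdot> H (Suc n))"
proof -
  define K where "K n = H (k + 2 * n)" for n
  define N where "N n = bracket_pow R a b (k + n) \<cdot> H n" for n
  have car: "u \<in> carrier R" if "u \<in> H j" for u j using H that by (metis ideal.Icarr)
  have aH: "a \<otimes> f \<in> H (Suc j)" and bH: "b \<otimes> f \<in> H (Suc j)" if "f \<in> H j" for f j
    using genideal_pair_prodI[OF a b that] red by auto
  have N_iff: "v \<in> N n \<longleftrightarrow> (\<exists>f\<in>H n. \<exists>g\<in>H n. v = a [^] (k + n) \<otimes> f \<oplus> b [^] (k + n) \<otimes> g)" for v n
    unfolding N_def bracket_pow_def using a b H by (intro genideal_pair_prod_iff) auto
  have c: "a \<otimes> b \<in> carrier R" using a b by simp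
  have idK: "ideal (K n) R" for n unfolding K_def by (rule H)
  have idN: "ideal (N n) R" for n
    unfolding N_def bracket_pow_def using a b H by (intro ideal_prod_is_ideal genideal_ideal) auto
  have cK: "a \<otimes> b \<otimes> u \<in> K (Suc n)" if "u \<in> K n" for u n
    using that a b car aH[OF bH] by (auto simp: K_def m_assoc)
  have cN: "a \<otimes> b \<otimes> u \<in> N (Suc n)" if u: "u \<in> N n" for u n
  proof -
    from u obtain f g where fg: "f \<in> H n" "g \<in> H n" "u = a [^] (k + n) \<otimes> f \<oplus> b [^] (k + n) \<otimes> g"
      unfolding N_iff by blast
    \<comment> \<open>One factor raises the exponent of the bracket power; the other moves the
      coefficient from \<open>H n\<close> to \<open>H (Suc n)\<close>.\<close>
    have "a \<otimes> b \<otimes> u = a [^] (k + Suc n) \<otimes> (b \<otimes> f) \<oplus> b [^] (k + Suc n) \<otimes> (a \<otimes> g)"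
      unfolding fg(3) using fg(1,2)[THEN car] a b by (simp add: r_distr m_ac)
    then show ?thesis unfolding N_iff using aH bH fg by blast
  qed
  have surj: "\<exists>u\<in>K n. \<exists>t\<in>N (Suc n). v = a \<otimes> b \<otimes> u \<oplus> t" if v: "v \<in> K (Suc n)" for v n
  proof -
    \<comment> \<open>Positivity of \<open>k\<close> gives \<open>k + Suc n\<close> \<ge> 2, the
      least exponent that the decomposition covers.\<close>
    obtain k' where k': "k = Suc k'" using \<open>0 < k\<close> by (cases k) auto
    have "v \<in> H (Suc n + Suc (Suc (k' + n)))"
      using v unfolding K_def k' by (simp add: mult_2 add_ac)
    \<comment> \<open>Starting the chain at \<open>H (Suc n)\<close> puts \<open>f\<close> and
      \<open>g\<close> where \<open>N (Suc n)\<close> wants them; \<open>h\<close> then has index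
      \<open>Suc n + (k' + n) = k + 2 * n\<close>.\<close>
    from reduction_chain_decomposition[of a b "\<lambda>j. H (Suc n + j)", OF a b H _ this] red
    obtain f g h where fgh: "f \<in> H (Suc n)" "g \<in> H (Suc n)" "h \<in> H (Suc n + (k' + n))"
      "v = a [^] Suc (Suc (k' + n)) \<otimes> f \<oplus> b [^] Suc (Suc (k' + n)) \<otimes> g \<oplus> a \<otimes> b \<otimes> h"
      by auto
    let ?t = "a [^] (k + Suc n) \<otimes> f \<oplus> b [^] (k + Suc n) \<otimes> g"
    have "v = a \<otimes> b \<otimes> h \<oplus> ?t"
      using fgh(1-3)[THEN car] a b unfolding fgh(4) k' by (simp add: a_comm)
    moreover have "?t \<in> N (Suc n)" unfolding N_iff using fgh by blast
    moreover have "h \<in> K n" using fgh(3) unfolding K_def k' by (simp add: mult_2 add_ac)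
    ultimately show ?thesis by blast
  qed
  obtain m where m: "\<forall>n\<ge>m. \<forall>u\<in>K n. a \<otimes> b \<otimes> u \<in> N (Suc n) \<longrightarrow> u \<in> N n"
    using surjective_system_eventually_injective[of "a \<otimes> b" K N, OF assms(1) c idK idN cN surj]
    by blast
  have "mult_induces_iso R (a \<otimes> b) (K n) (N n) (K (Suc n)) (N (Suc n))" if "n \<ge> m" for n
    using m that by (intro mult_induces_isoI idN idK c cK cN surj) auto
  then show ?thesis unfolding K_def N_def by blast
qed

section \<open>Powers of ideals and the chain built from \<open>I\<close> and
  \<open>J\<close>\<close>

lemma (in cring) ideals_set_simps:
  "carrier (ideals_set R) = {I. ideal I R}" "monoid.mult (ideals_set R) = ideal_prod R"
  by (simp_all add: ideals_set_def)

lemma (in cring) ideal_pow_is_ideal: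
  assumes "ideal I R"
  shows "ideal (ideal_pow R I n) R"
proof -
  interpret ISet: comm_monoid "ideals_set R" by (rule ideals_set_is_comm_monoid)
  show ?thesis using ISet.nat_pow_closed[of I n] assms by (simp add: ideals_set_simps)
qed

text \<open>Multiply \<open>L (IJ)^n0 = (IJ)^(n0+1)\<close> by \<open>I^(p-n0) J^(q-n0)\<close>.
  This frees the exponents of \<open>I\<close> and \<open>J\<close> from being equal, as different
  \<open>r\<close> and \<open>s\<close> demand.\<close>

lemma (in cring) reduction_of_prod_eventually:
  assumes "ideal I R" "ideal J R" "reduction_of R L (I \<cdot> J)"
  shows "\<exists>n0. \<forall>p\<ge>n0. \<forall>q\<ge>n0. L \<cdot> (ideal_pow R I p \<cdot> ideal_pow R J q)
           = ideal_pow R I (Suc p) \<cdot> ideal_pow R J (Suc q)"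
proof -
  interpret S: comm_monoid "ideals_set R" by (rule ideals_set_is_comm_monoid)
  have in_S: "I \<in> carrier (ideals_set R)" "J \<in> carrier (ideals_set R)" "L \<in> carrier (ideals_set R)"
    using assms by (simp_all add: ideals_set_simps reduction_of_def)
  \<comment> \<open>Makes the laws of the commutative monoid of ideals available to the
    simplifier.\<close>
  have [simp]: "ideal_prod R = monoid.mult (ideals_set R)" by (simp add: ideals_set_simps)
  obtain n0 where n0: "L \<cdot> ideal_pow R (I \<cdot> J) n0 = ideal_pow R (I \<cdot> J) (n0 + 1)"
    using assms(3) unfolding reduction_of_def by blast
  have "L \<cdot> (ideal_pow R I p \<cdot> ideal_pow R J q) = ideal_pow R I (Suc p) \<cdot> ideal_pow R J (Suc q)"
    if pq: "p \<ge> n0" "q \<ge> n0" for p q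
  proof -
    \<comment> \<open>Stated for all \<open>m\<close> because it serves both sides of the reduction
      equation, at \<open>n0\<close> and at \<open>n0 + 1\<close>.\<close>
    have split: "ideal_pow R I (m + (p - n0)) \<cdot> ideal_pow R J (m + (q - n0))
        = ideal_pow R (I \<cdot> J) m \<cdot> (ideal_pow R I (p - n0) \<cdot> ideal_pow R J (q - n0))" for m
      using in_S by (simp add: S.nat_pow_distrib S.m_ac flip: S.nat_pow_mult)
    have "L \<cdot> (ideal_pow R I p \<cdot> ideal_pow R J q)
        = L \<cdot> (ideal_pow R (I \<cdot> J) n0 \<cdot> (ideal_pow R I (p - n0) \<cdot> ideal_pow R J (q - n0)))"
      using split[of n0] pq by simp
    also have "\<dots> = (L \<cdot> ideal_pow R (I \<cdot> J) n0) \<cdot> (ideal_pow R I (p - n0) \<cdot> ideal_pow R J (q - n0))"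
      using in_S by (simp add: S.m_assoc)
    also have "\<dots> = ideal_pow R I (Suc p) \<cdot> ideal_pow R J (Suc q)"
      unfolding n0 using split[of "n0 + 1"] pq by (simp add: Suc_diff_le)
    finally show ?thesis .
  qed
  then show ?thesis by blast
qed

theorem lemma4p4:
  fixes R :: "('a, 'b) ring_scheme" (structure)
    and \<mm> I J :: "'a set" and x y z w :: 'a and r s :: int
  assumes "cohen_macaulay_local_ring R \<mm>"
    and "krull_dim R = 2"
    and "infinite (carrier (R Quot \<mm>))"
    and "primary_to R \<mm> I" and "primary_to R \<mm> J"
    and "complete_reduction R I J x y z w"
  shows "\<exists>k0::nat. \<forall>k\<ge>k0. 0 \<le> int k + r \<longrightarrow> 0 \<le> int k + s \<longrightarrow>
    mult_induces_iso R (x \<otimes> z \<otimes> y \<otimes> w)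
      (ideal_pow R I (nat (2 * int k + r)) \<cdot> ideal_pow R J (nat (2 * int k + s)))
      (bracket_pow R (x \<otimes> z) (y \<otimes> w) k
         \<cdot> ideal_pow R I (nat (int k + r)) \<cdot> ideal_pow R J (nat (int k + s)))
      (ideal_pow R I (nat (2 * int k + r + 2)) \<cdot> ideal_pow R J (nat (2 * int k + s + 2)))
      (bracket_pow R (x \<otimes> z) (y \<otimes> w) (k + 1)
         \<cdot> ideal_pow R I (nat (int k + r + 1)) \<cdot> ideal_pow R J (nat (int k + s + 1)))"
proof -
  have "cring R" and noeth: "noetherian_ring R"
    using assms(1) unfolding cohen_macaulay_local_ring_def noetherian_local_ring_def by auto
  then interpret cring R by simp
  have I: "ideal I R" and J: "ideal J R"
    using assms(4,5) unfolding primary_to_def primary_ideal_def by auto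
  have mem: "x \<in> carrier R" "y \<in> carrier R" "z \<in> carrier R" "w \<in> carrier R"
    using assms(6) I J unfolding complete_reduction_def by (auto intro: ideal.Icarr)
  then have ab: "x \<otimes> z \<in> carrier R" "y \<otimes> w \<in> carrier R" by auto
  have c: "x \<otimes> z \<otimes> y \<otimes> w = (x \<otimes> z) \<otimes> (y \<otimes> w)" using mem by (simp add: m_assoc)
  note F_ideal = ideal_pow_is_ideal[OF I] ideal_pow_is_ideal[OF J]
  have brI: "ideal (bracket_pow R (x \<otimes> z) (y \<otimes> w) n) R" for n
    unfolding bracket_pow_def using ab by (intro genideal_ideal) auto
  have "reduction_of R (Idl {x \<otimes> z, y \<otimes> w}) (I \<cdot> J)"
    using assms(6) unfolding complete_reduction_def by blast
  from reduction_of_prod_eventually[OF I J this] obtain n0 where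
    n0: "\<forall>p\<ge>n0. \<forall>q\<ge>n0. (Idl {x \<otimes> z, y \<otimes> w}) \<cdot> (ideal_pow R I p \<cdot> ideal_pow R J q)
        = ideal_pow R I (Suc p) \<cdot> ideal_pow R J (Suc q)" ..
  \<comment> \<open>Large enough that \<open>k + r\<close> and \<open>k + s\<close> are both at
    least \<open>n0\<close>, whatever the signs of \<open>r\<close> and \<open>s\<close>; the
    successor makes \<open>k\<close> positive.\<close>
  define k where "k = Suc (n0 + nat \<bar>r\<bar> + nat \<bar>s\<bar>)"
  define p where "p = nat (int k + r)"
  define q where "q = nat (int k + s)"
  have p: "int p = int k + r" "p \<ge> n0" and q: "int q = int k + s" "q \<ge> n0"
    unfolding p_def q_def k_def by auto
  \<comment> \<open>With \<open>l = k + n\<close>, the exponent \<open>2 l + r\<close> equals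
    \<open>p + (k + 2 n)\<close> and \<open>l + r\<close> equals \<open>p + n\<close>, and likewise
    for \<open>s\<close> and \<open>q\<close>. So the source at \<open>l\<close> is the quotient of
    \<open>H (k + 2 * n)\<close> treated above.\<close>
  define H where "H j = ideal_pow R I (p + j) \<cdot> ideal_pow R J (q + j)" for j
  have idH: "ideal (H j) R" for j unfolding H_def by (intro ideal_prod_is_ideal F_ideal)
  have red: "(Idl {x \<otimes> z, y \<otimes> w}) \<cdot> H j = H (Suc j)" for j
    unfolding H_def using n0[rule_format, of "p + j" "q + j"] p q by simp
  have "0 < k" unfolding k_def by simp
  from reduction_chain_mult_induces_iso[of "x \<otimes> z" "y \<otimes> w" H k, OF noeth ab idH red this]
  obtain m where m: "\<forall>n\<ge>m. mult_induces_iso R (x \<otimes> z \<otimes> y \<otimes> w)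
      (H (k + 2 * n)) (bracket_pow R (x \<otimes> z) (y \<otimes> w) (k + n) \<cdot> H n)
      (H (k + 2 * Suc n)) (bracket_pow R (x \<otimes> z) (y \<otimes> w) (k + Suc n) \<cdot> H (Suc n))"
    unfolding c ..
  show ?thesis
  proof (intro exI allI impI)
    fix l assume "l \<ge> k + m"
    define n where "n = l - k"
    have n: "l = k + n" "n \<ge> m" using \<open>l \<ge> k + m\<close> unfolding n_def by auto
    have e: "nat (2 * int l + r) = p + (k + 2 * n)" "nat (2 * int l + s) = q + (k + 2 * n)"
      "nat (2 * int l + r + 2) = p + (k + 2 * Suc n)" "nat (2 * int l + s + 2) = q + (k + 2 * Suc n)"
      "nat (int l + r) = p + n" "nat (int l + s) = q + n"
      "nat (int l + r + 1) = p + Suc n" "nat (int l + s + 1) = q + Suc n"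
      "l + 1 = k + Suc n"
      using p q n by (simp_all add: nat_eq_iff)
    show "mult_induces_iso R (x \<otimes> z \<otimes> y \<otimes> w)
      (ideal_pow R I (nat (2 * int l + r)) \<cdot> ideal_pow R J (nat (2 * int l + s)))
      (bracket_pow R (x \<otimes> z) (y \<otimes> w) l
         \<cdot> ideal_pow R I (nat (int l + r)) \<cdot> ideal_pow R J (nat (int l + s)))
      (ideal_pow R I (nat (2 * int l + r + 2)) \<cdot> ideal_pow R J (nat (2 * int l + s + 2)))
      (bracket_pow R (x \<otimes> z) (y \<otimes> w) (l + 1)
         \<cdot> ideal_pow R I (nat (int l + r + 1)) \<cdot> ideal_pow R J (nat (int l + s + 1)))"
      \<comment> \<open>The product in the goal associates to the left, whereas \<open>H\<close>
        groups the powers of \<open>I\<close> and \<open>J\<close> together.\<close>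
      using m[rule_format, OF n(2)] unfolding e H_def n(1)[symmetric]
      by (simp only: ideal_prod_assoc[OF brI F_ideal])
  qed
qed

end
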